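(* If $\square_{\aleph_\omega}$ holds and $\mathrm{cov}(\aleph_\omega,\omega)=\aleph_{\omega+1}$, then $\mathrm{Nt}((2^{\aleph_\omega})_\delta)=\aleph_1$.
   Context: For a cardinal $\kappa$, a family $\mathcal B$ of sets is called $\kappa^{\mathrm{op}}$-like if for every $U\in\mathcal B$ the set $\{V\in\mathcal B: U\subseteq V\}$ has cardinality $<\kappa$. The Noetherian type $\mathrm{Nt}(X)$ of a topological space $X$ is the least infinite cardinal $\kappa$ such that $X$ has a base which is $\kappa^{\mathrm{op}}$-like. $X_\delta$ is the set $X$ with the topology generated by all $G_\delta$ subsets of $X$. Here $2^{\aleph_\omega}$ denotes the Cantor cube $\{0,1\}^{\aleph_\omega}$ with the product topology. $\mathrm{cov}(\theta,\kappa)$ is the least size of a collection $\mathcal A\subseteq[\theta]^\kappa$ such that every $X\in[\theta]^\kappa$ is contained in some member of $\mathcal A$. $\square_{\aleph_\omega}$ is Jensen's square principle: there is a sequence $\langle C_\alpha:\alpha<\aleph_{\omega+1}\text{ limit}\rangle$ such that each $C_\alpha$ is closed unbounded in $\alpha$ of order type at most $\omega_\omega$, and $C_\beta=C_\alpha\cap\beta$ whenever $\beta$ is a limit point of $C_\alpha$. *)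

theory Defs
  imports "HOL-Analysis.Analysis"
begin

unbundle cardinal_syntax

text \<open>
  Cardinals are the cardinal orders of the HOL library, compared by the order isomorphism
  relations \<open>=o\<close>, \<open>\<le>o\<close> and \<open><o\<close>; \<open>natLeq\<close> is \<open>\<omega>\<close> and \<open>cardSuc\<close> is the cardinal successor.
  A cardinal order is an initial ordinal: an ordinal below it is represented by an element of
  its field, with \<open>underS\<close> as the set of smaller ordinals.
  In the definitions below, a quantifier over relations on a fixed type ranges over the
  cardinals having a representative on that type.  This loses nothing: the only
  cardinals relevant there are bounded by one that lives on the type, and every cardinal below it
  is then represented as well.
\<close>

primrec is_aleph :: "nat \<Rightarrow> 'a rel \<Rightarrow> bool" where
  "is_aleph 0 r \<longleftrightarrow> Card_order r \<and> r =o natLeq"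
| "is_aleph (Suc n) r \<longleftrightarrow> Card_order r \<and> (\<exists>s :: 'a rel. is_aleph n s \<and> r =o cardSuc s)"

text \<open>\<open>\<aleph>\<^sub>\<omega>\<close> is the least upper bound of the \<open>\<aleph>\<^sub>n\<close>; each \<open>\<aleph>\<^sub>n\<close> is required to exist on the type.\<close>

definition is_aleph_omega :: "'a rel \<Rightarrow> bool" where
  "is_aleph_omega r \<longleftrightarrow> Card_order r
     \<and> (\<forall>n. \<exists>s :: 'a rel. is_aleph n s \<and> s <o r)
     \<and> (\<forall>t :: 'a rel. Card_order t \<and> (\<forall>n. \<forall>s :: 'a rel. is_aleph n s \<longrightarrow> s \<le>o t) \<longrightarrow> r \<le>o t)"

definition subsets_of_card :: "'a set \<Rightarrow> 'k rel \<Rightarrow> 'a set set" where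
  "subsets_of_card A \<kappa> = {X. X \<subseteq> A \<and> |X| =o \<kappa>}"

definition covering_family :: "'a rel \<Rightarrow> 'k rel \<Rightarrow> 'a set set \<Rightarrow> bool" where
  "covering_family \<theta> \<kappa> \<A> \<longleftrightarrow> \<A> \<subseteq> subsets_of_card (Field \<theta>) \<kappa>
     \<and> (\<forall>X \<in> subsets_of_card (Field \<theta>) \<kappa>. \<exists>Y \<in> \<A>. X \<subseteq> Y)"

text \<open>\<open>cov_eq \<theta> \<kappa> \<mu>\<close> says that \<open>cov(\<theta>, \<kappa>) = \<mu>\<close>.\<close>

definition cov_eq :: "'a rel \<Rightarrow> 'k rel \<Rightarrow> 'm rel \<Rightarrow> bool" where
  "cov_eq \<theta> \<kappa> \<mu> \<longleftrightarrow> (\<exists>\<A>. covering_family \<theta> \<kappa> \<A> \<and> |\<A>| =o \<mu>)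
     \<and> (\<forall>\<A>. covering_family \<theta> \<kappa> \<A> \<longrightarrow> \<mu> \<le>o |\<A>| )"

definition limit_elt :: "'a rel \<Rightarrow> 'a \<Rightarrow> bool" where
  "limit_elt s \<alpha> \<longleftrightarrow> \<alpha> \<in> Field s \<and> underS s \<alpha> \<noteq> {}
     \<and> (\<forall>\<beta> \<in> underS s \<alpha>. \<exists>\<gamma> \<in> underS s \<alpha>. \<beta> \<in> underS s \<gamma>)"

definition limit_point_of :: "'a rel \<Rightarrow> 'a set \<Rightarrow> 'a \<Rightarrow> bool" where
  "limit_point_of s C \<beta> \<longleftrightarrow> \<beta> \<in> Field s \<and> underS s \<beta> \<noteq> {}
     \<and> (\<forall>\<gamma> \<in> underS s \<beta>. \<exists>\<delta> \<in> C \<inter> underS s \<beta>. \<gamma> \<in> underS s \<delta>)"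

definition club_in :: "'a rel \<Rightarrow> 'a set \<Rightarrow> 'a \<Rightarrow> bool" where
  "club_in s C \<alpha> \<longleftrightarrow> C \<subseteq> underS s \<alpha>
     \<and> (\<forall>\<beta> \<in> underS s \<alpha>. \<exists>\<gamma> \<in> C. (\<beta>, \<gamma>) \<in> s)
     \<and> (\<forall>\<beta> \<in> underS s \<alpha>. limit_point_of s C \<beta> \<longrightarrow> \<beta> \<in> C)"

text \<open>
  Jensen's square at the cardinal \<open>\<mu>\<close>.  The ordinals below \<open>\<mu>\<^sup>+\<close> are the elements of
  \<open>Field (cardSuc \<mu>)\<close>, and \<open>Restr s C \<le>o \<mu>\<close> bounds the order type of \<open>C\<close> by the initial ordinal \<open>\<mu>\<close>.
  Values of \<open>C\<close> at non-limit arguments are irrelevant, since a limit point is a limit ordinal.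
\<close>

definition square :: "'a rel \<Rightarrow> bool" where
  "square \<mu> \<longleftrightarrow> (let s = cardSuc \<mu> in
     \<exists>C. \<forall>\<alpha>. limit_elt s \<alpha> \<longrightarrow>
       club_in s (C \<alpha>) \<alpha> \<and> Restr s (C \<alpha>) \<le>o \<mu>
       \<and> (\<forall>\<beta>. limit_point_of s (C \<alpha>) \<beta> \<longrightarrow> C \<beta> = C \<alpha> \<inter> underS s \<beta>))"

definition op_like :: "'k rel \<Rightarrow> 'a set set \<Rightarrow> bool" where
  "op_like \<kappa> \<B> \<longleftrightarrow> (\<forall>U \<in> \<B>. |{V \<in> \<B>. U \<subseteq> V}| <o \<kappa>)"

definition base_of :: "'a topology \<Rightarrow> 'a set set \<Rightarrow> bool" where
  "base_of X \<B> \<longleftrightarrow> (\<forall>V \<in> \<B>. openin X V)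
     \<and> (\<forall>U x. openin X U \<and> x \<in> U \<longrightarrow> (\<exists>V \<in> \<B>. x \<in> V \<and> V \<subseteq> U))"

text \<open>\<open>Nt_eq X \<kappa>\<close> says that \<open>Nt(X) = \<kappa>\<close>.\<close>

definition Nt_eq :: "'a topology \<Rightarrow> 'k rel \<Rightarrow> bool" where
  "Nt_eq X \<kappa> \<longleftrightarrow> Cinfinite \<kappa> \<and> (\<exists>\<B>. base_of X \<B> \<and> op_like \<kappa> \<B>)
     \<and> (\<forall>\<mu> :: 'k rel. Cinfinite \<mu> \<and> (\<exists>\<B>. base_of X \<B> \<and> op_like \<mu> \<B>) \<longrightarrow> \<kappa> \<le>o \<mu>)"

lemma Nt_eq_minimal:
  fixes \<kappa> :: "'k rel" and \<mu> :: "'m rel"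
  assumes "Nt_eq X \<kappa>" and "Cinfinite \<mu>" and "base_of X \<B>" and "op_like \<mu> \<B>"
  shows "\<kappa> \<le>o \<mu>"
proof (rule ccontr)
  assume "\<not> \<kappa> \<le>o \<mu>"
  moreover have "Card_order \<kappa>" using assms(1) by (simp add: Nt_eq_def)
  then have "Well_order \<kappa>" by (rule card_order_on_well_order_on)
  moreover have "Well_order \<mu>" using assms(2) by (simp add: card_order_on_well_order_on)
  ultimately have "\<mu> <o \<kappa>" by (simp add: not_ordLeq_iff_ordLess)
  then obtain \<nu> :: "'k rel" where \<nu>: "\<mu> =o \<nu>" "\<nu> <o \<kappa>"
    by (auto simp: internalize_ordLess[of \<mu> \<kappa>])
  have "Cinfinite \<nu>" using Cinfinite_cong[OF \<nu>(1) assms(2)] .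
  moreover have "op_like \<nu> \<B>"
    using assms(4) \<nu>(1) unfolding op_like_def
    by (meson ordLess_ordIso_trans)
  ultimately have "\<kappa> \<le>o \<nu>" using assms(1,3) unfolding Nt_eq_def by meson
  with \<nu>(2) show False by (simp add: not_ordLess_ordLeq)
qed

definition G_delta_topology :: "'a topology \<Rightarrow> 'a topology" where
  "G_delta_topology X = topology_generated_by {S. gdelta_in X S}"

definition cantor_cube :: "'a set \<Rightarrow> ('a \<Rightarrow> bool) topology" where
  "cantor_cube I = product_topology (\<lambda>_. discrete_topology UNIV) I"

end

theory Submission
  imports Defs "HOL-Library.Countable_Set_Type"
begin

text \<open>
  A set that is open in the \<open>G\<^sub>\<delta>\<close> topology contains, around each of its points, a cylinder fixing
  countably many coordinates.  The upper bound \<open>\<aleph>\<^sub>1\<close> therefore reduces to combinatorics: it suffices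
  to cover the countable subsets of \<open>\<aleph>\<^sub>\<omega>\<close> by a family of countable sets that is sparse, in the sense
  that every countable set includes only countably many members.  The cylinders over members of such
  a family form the required base (\<open>op_like_base_of_sparse_cover\<close>).

  By the hypothesis on covering numbers there is a covering family of size \<open>\<aleph>\<^bsub>\<omega>+1\<^esub>\<close>, so it is enough
  to find one sparse sequence of \<open>\<aleph>\<^bsub>\<omega>+1\<^esub>\<close> countable sets and to add its terms to the members of the
  covering family (\<open>sparse_cover_of_square\<close>).  The sparse sequence consists of the ranges of
  functions \<open>f\<^sub>\<alpha> \<in> \<Prod>n. \<omega>\<^bsub>n+1\<^esub>\<close> that increase modulo finite with \<open>\<alpha>\<close>, and square is what makes the
  increase uniform where it matters (\<open>square_sparse_functions\<close>).  Given uncountably many \<open>\<alpha>\<close>, let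
  \<open>\<gamma>\<close> be the least ordinal below which there are uncountably many of them.  It has uncountable
  cofinality, so \<open>C\<^sub>\<gamma>\<close> has size less than \<open>\<aleph>\<^sub>\<omega>\<close> and its limit points are cofinal in \<open>\<gamma>\<close>.  By
  coherence, \<open>f\<^sub>\<xi>(n)\<close> increases with \<open>\<xi>\<close> along these limit points for every large \<open>n\<close>, with one
  bound on \<open>n\<close> for all of them.  Interleaving the given \<open>\<alpha>\<close> with the limit points yields an \<open>n\<close> at
  which the values \<open>f\<^sub>\<alpha>(n)\<close> form an uncountable set (\<open>uncountable_values\<close>).

  The lower bound holds because countable intersections of open sets are open and no point is
  isolated: below a strictly decreasing sequence of basic sets around a point there is another basic
  set, so that no base is \<open>\<omega>\<^sup>o\<^sup>p\<close>-like (\<open>base_has_set_with_infinitely_many_supersets\<close>).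
\<close>

section \<open>Well-orders and increasing functions\<close>

lemma well_order_underS_trans:
  assumes "Well_order s" "x \<in> underS s y" "y \<in> underS s z"
  shows "x \<in> underS s z"
proof -
  have "trans s" "antisym s"
    using assms(1) by (auto simp: order_on_defs)
  then show ?thesis
    using assms(2,3) unfolding underS_def by (auto dest: transD antisymD)
qed

lemma well_order_linear:
  assumes "Well_order s" "x \<in> Field s" "y \<in> Field s"
  shows "x \<in> underS s y \<or> x = y \<or> y \<in> underS s x"
  using assms unfolding order_on_defs total_on_def underS_def by blast

lemma well_order_not_both:
  assumes "Well_order s" "x \<in> underS s y" "y \<in> underS s x"
  shows False
  using well_order_underS_trans[OF assms] by (simp add: underS_def)

lemma well_order_least:
  assumes "Well_order s" "A \<subseteq> Field s" "A \<noteq> {}"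
  obtains a where "a \<in> A" "\<And>b. b \<in> A \<Longrightarrow> b \<notin> underS s a"
proof -
  have "wf (s - Id)"
    using assms(1) by (simp add: well_order_on_def)
  from wfE_min'[OF this assms(3)] obtain a where "a \<in> A" "\<And>y. (y, a) \<in> s - Id \<Longrightarrow> y \<notin> A"
    by blast
  with that show ?thesis by (auto simp: underS_def)
qed

text \<open>
  Regularity only says that \<open>X\<close> is not cofinal.  An infinite cardinal is a limit, so passing to a
  larger element turns a weak bound into a strict one.
\<close>

lemma regularCard_strict_bound:
  assumes "Cinfinite k" "regularCard k" "X \<subseteq> Field k" "|X| <o k"
  shows "\<exists>b \<in> Field k. X \<subseteq> underS k b"
proof -
  have W: "Well_order k"
    using assms(1) by (simp add: card_order_on_well_order_on)
  have "\<not> cofinal X k"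
    using assms unfolding regularCard_def by (meson not_ordLess_ordIso)
  then obtain a where a: "a \<in> Field k" "\<And>b. b \<in> X \<Longrightarrow> a \<noteq> b \<Longrightarrow> (a, b) \<notin> k"
    unfolding cofinal_def by blast
  obtain c where c: "c \<in> Field k" "a \<in> underS k c"
    using infinite_Card_order_limit[of k a] assms(1) a(1)
    by (auto simp: cinfinite_def underS_def)
  have "x \<in> underS k c" if "x \<in> X" for x
    using well_order_linear[OF W, of x a] a that assms(3) c well_order_underS_trans[OF W, of x a c]
    by (auto simp: underS_def)
  with c(1) show ?thesis by blast
qed

text \<open>
  Well-founded recursion on \<open>a\<close>: at stage \<open>a\<close> fewer than \<open>k\<close> earlier values have to be
  exceeded, which the regularity of \<open>k\<close> permits.
\<close>

lemma ex_strictly_increasing_along: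
  assumes "Well_order s" "Cinfinite k" "regularCard k"
    and D: "\<And>a. a \<in> Field s \<Longrightarrow> D a \<subseteq> underS s a"
    and small: "\<And>a. a \<in> Field s \<Longrightarrow> |D a| <o k"
  shows "\<exists>f. \<forall>a \<in> Field s. f a \<in> Field k \<and> (\<forall>b \<in> D a. f b \<in> underS k (f a))"
proof -
  define G where "G = (\<lambda>f a. SOME v. v \<in> Field k \<and> f ` D a \<subseteq> underS k v)"
  define f where "f = wfrec (s - Id) G"
  have wf: "wf (s - Id)"
    using assms(1) by (simp add: well_order_on_def)
  have *: "f a \<in> Field k \<and> (\<forall>b \<in> D a. f b \<in> underS k (f a))" if "a \<in> Field s" for a
    using wf that
  proof (induction a rule: wf_induct_rule)
    case (less a)
    have sub: "(b, a) \<in> s - Id" "b \<in> Field s" if "b \<in> D a" for b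
      using D[OF less.prems] that by (auto simp: underS_def Field_def)
    have cut: "cut f (s - Id) a ` D a = f ` D a"
      using sub by (auto simp: cut_apply intro!: image_cong)
    have "f a = G (cut f (s - Id) a) a"
      unfolding f_def by (rule wfrec[OF wf])
    then have fa: "f a = (SOME v. v \<in> Field k \<and> f ` D a \<subseteq> underS k v)"
      by (simp add: G_def cut)
    have "\<exists>v \<in> Field k. f ` D a \<subseteq> underS k v"
    proof (rule regularCard_strict_bound[OF assms(2,3)])
      show "f ` D a \<subseteq> Field k"
        using less.IH sub by blast
      show "|f ` D a| <o k"
        using card_of_image small[OF less.prems] by (rule ordLeq_ordLess_trans)
    qed
    then have "f a \<in> Field k \<and> f ` D a \<subseteq> underS k (f a)"
      unfolding fa Bex_def by (rule someI_ex)
    then show ?case by blast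
  qed
  then show ?thesis by blast
qed

section \<open>Uncountable cofinality\<close>

text \<open>
  For limit elements this is \<open>cf \<gamma> > \<omega>\<close>.  Asking for a strict bound excludes zero and successors
  (take \<open>X\<close> empty or a singleton), so that \<open>\<gamma>\<close> is always a limit element.
\<close>

definition uncountable_cofinality :: "'b rel \<Rightarrow> 'b \<Rightarrow> bool" where
  "uncountable_cofinality s \<gamma> \<longleftrightarrow> \<gamma> \<in> Field s \<and>
     (\<forall>X. X \<subseteq> underS s \<gamma> \<and> countable X \<longrightarrow> (\<exists>b \<in> underS s \<gamma>. X \<subseteq> underS s b))"

text \<open>
  Take the least \<open>\<gamma>\<close> below which \<open>S\<close> has uncountably many elements; some \<open>\<gamma>\<close> has this property since
  \<open>S\<close> has a subset of size \<open>\<aleph>\<^sub>1\<close>, which is bounded because \<open>s\<close> is regular and larger.  A countable set cofinal in \<open>\<gamma>\<close> would, by minimality,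
  split \<open>S\<close> below \<open>\<gamma>\<close> into countably many countable pieces.
\<close>

lemma uncountable_set_cofinal_at:
  assumes "Cinfinite s" "regularCard s" "cardSuc natLeq <o s"
    and S: "S \<subseteq> Field s" "uncountable S"
  obtains \<gamma> where "uncountable_cofinality s \<gamma>"
    and "\<And>b. b \<in> underS s \<gamma> \<Longrightarrow> \<exists>a \<in> S \<inter> underS s \<gamma>. b \<in> underS s a"
proof -
  have W: "Well_order s"
    using assms(1) by (simp add: card_order_on_well_order_on)
  have cN: "Card_order (cardSuc natLeq)"
    by (rule cardSuc_Card_order[OF natLeq_Card_order])
  have "\<not> |S| \<le>o natLeq"
    using S(2) by (simp add: countable_card_le_natLeq)
  then have "natLeq <o |S|"
    using not_ordLeq_iff_ordLess[OF natLeq_Well_order card_of_Well_order] by blast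
  then have "cardSuc natLeq \<le>o |S|"
    using cardSuc_ordLess_ordLeq[OF natLeq_Card_order card_of_Card_order] by blast
  then have "|Field (cardSuc natLeq)| \<le>o |S|"
    using card_of_Field_ordIso[OF cN] by (rule ordIso_ordLeq_trans[rotated])
  then obtain h where h: "inj_on h (Field (cardSuc natLeq))" "h ` Field (cardSuc natLeq) \<subseteq> S"
    by (auto simp: card_of_ordLeq[symmetric])
  define T where "T = h ` Field (cardSuc natLeq)"
  have T: "|T| =o cardSuc natLeq"
    unfolding T_def using h(1) card_of_Field_ordIso[OF cN]
    by (meson bij_betw_imageI card_of_ordIsoI ordIso_symmetric ordIso_transitive)
  then have "|T| <o s"
    using assms(3) by (rule ordIso_ordLess_trans)
  then obtain b where b: "b \<in> Field s" "T \<subseteq> underS s b"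
    using regularCard_strict_bound[OF assms(1,2), of T] h(2) S(1) by (auto simp: T_def)
  have "uncountable T"
  proof
    assume "countable T"
    then have "|T| \<le>o natLeq"
      by (simp add: countable_card_le_natLeq)
    then have "cardSuc natLeq \<le>o natLeq"
      using T by (meson ordIso_ordLeq_trans ordIso_symmetric)
    then show False
      using cardSuc_greater[OF natLeq_Card_order] not_ordLess_ordLeq by blast
  qed
  moreover have "T \<subseteq> S \<inter> underS s b"
    using b h(2) by (auto simp: T_def)
  ultimately have "uncountable (S \<inter> underS s b)"
    using countable_subset by blast
  then have "{c \<in> Field s. uncountable (S \<inter> underS s c)} \<noteq> {}"
    using b(1) by blast
  then obtain \<gamma> where \<gamma>: "\<gamma> \<in> Field s" "uncountable (S \<inter> underS s \<gamma>)"
    and least: "\<And>c. c \<in> Field s \<Longrightarrow> uncountable (S \<inter> underS s c) \<Longrightarrow> c \<notin> underS s \<gamma>"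
    by (rule well_order_least[OF W, rotated]) auto
  have F: "c \<in> Field s" if "c \<in> underS s \<gamma>" for c
    using that by (auto simp: underS_def Field_def)
  have ctbl: "countable (S \<inter> (underS s c \<union> {c}))" if "c \<in> underS s \<gamma>" for c
  proof -
    have "countable (S \<inter> underS s c)"
      using least[OF F[OF that]] that by blast
    moreover have "S \<inter> (underS s c \<union> {c}) \<subseteq> insert c (S \<inter> underS s c)" by blast
    ultimately show ?thesis by (meson countable_insert countable_subset)
  qed
  have "uncountable_cofinality s \<gamma>"
    unfolding uncountable_cofinality_def
  proof (intro conjI allI impI \<gamma>(1))
    fix X assume X: "X \<subseteq> underS s \<gamma> \<and> countable X"
    show "\<exists>b \<in> underS s \<gamma>. X \<subseteq> underS s b"
    proof (rule ccontr)
      assume no: "\<not> ?thesis"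
      have "S \<inter> underS s \<gamma> \<subseteq> (\<Union>c \<in> X. S \<inter> (underS s c \<union> {c}))"
      proof
        fix a assume a: "a \<in> S \<inter> underS s \<gamma>"
        with no obtain c where "c \<in> X" "c \<notin> underS s a" by blast
        with a X show "a \<in> (\<Union>c \<in> X. S \<inter> (underS s c \<union> {c}))"
          using well_order_linear[OF W, of a c] F by blast
      qed
      moreover have "countable (\<Union>c \<in> X. S \<inter> (underS s c \<union> {c}))"
        using X ctbl by blast
      ultimately show False
        using \<gamma>(2) countable_subset by blast
    qed
  qed
  moreover have "\<exists>a \<in> S \<inter> underS s \<gamma>. b \<in> underS s a" if b: "b \<in> underS s \<gamma>" for b
  proof (rule ccontr)
    assume no: "\<not> ?thesis"
    have "S \<inter> underS s \<gamma> \<subseteq> S \<inter> (underS s b \<union> {b})"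
      using no well_order_linear[OF W _ F[OF b]] F by blast
    then show False
      using \<gamma>(2) ctbl[OF b] countable_subset by blast
  qed
  ultimately show ?thesis using that by blast
qed

text \<open>
  The point where the increasing functions become incompressible.  Between any two sufficiently
  distant \<open>x, y \<in> L\<close> lies some \<open>a \<in> S\<close>, so \<open>f n x < f n a < f n y\<close> for all large \<open>n\<close>, where the
  threshold depends on \<open>x\<close>.  Because \<open>\<gamma>\<close> has uncountable cofinality, a single \<open>n\<close> serves cofinally
  many \<open>x \<in> L\<close>.  For that \<open>n\<close> the values \<open>f n a\<close> are cofinal in those \<open>f n x\<close>, and these increase
  along \<open>L\<close>; countably many values would be overtaken at a single \<open>x\<close>.
\<close>

lemma uncountable_values:
  assumes W: "Well_order s" and k: "\<And>n::nat. Well_order (k n)"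
    and \<gamma>: "uncountable_cofinality s \<gamma>"
    and f: "\<And>n a. a \<in> Field s \<Longrightarrow> f n a \<in> Field (k n)"
    and dom: "\<And>a b. a \<in> underS s \<gamma> \<Longrightarrow> b \<in> underS s a \<Longrightarrow>
        \<exists>m. \<forall>n \<ge> m. f n b \<in> underS (k n) (f n a)"
    and L: "L \<subseteq> underS s \<gamma>" "\<And>b. b \<in> underS s \<gamma> \<Longrightarrow> \<exists>x \<in> L. b \<in> underS s x"
    and mono: "\<And>n x y. n \<ge> n0 \<Longrightarrow> x \<in> L \<Longrightarrow> y \<in> L \<Longrightarrow> x \<in> underS s y \<Longrightarrow>
        f n x \<in> underS (k n) (f n y)"
    and S: "S \<subseteq> underS s \<gamma>" "\<And>b. b \<in> underS s \<gamma> \<Longrightarrow> \<exists>a \<in> S. b \<in> underS s a"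
  shows "\<exists>n. uncountable (f n ` S)"
proof (rule ccontr)
  assume "\<not> ?thesis"
  then have ctbl: "countable (f n ` S)" for n by blast
  have F: "a \<in> Field s" if "a \<in> underS s \<gamma>" for a
    using that by (auto simp: underS_def Field_def)
  have cf: "\<exists>b \<in> underS s \<gamma>. X \<subseteq> underS s b" if "X \<subseteq> underS s \<gamma>" "countable X" for X
    using \<gamma> that unfolding uncountable_cofinality_def by blast
  have "\<exists>n \<ge> n0. \<exists>a \<in> S. \<exists>y \<in> L.
          f n x \<in> underS (k n) (f n a) \<and> f n a \<in> underS (k n) (f n y)" if x: "x \<in> L" for x
  proof -
    obtain a where a: "a \<in> S" "x \<in> underS s a" using S(2) x L(1) by blast
    obtain y where y: "y \<in> L" "a \<in> underS s y" using L(2) a(1) S(1) by blast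
    obtain m where m: "\<forall>n \<ge> m. f n x \<in> underS (k n) (f n a)"
      using dom[of a x] a S(1) by blast
    obtain m' where m': "\<forall>n \<ge> m'. f n a \<in> underS (k n) (f n y)"
      using dom[of y a] y L(1) by blast
    show ?thesis
      using m m' by (intro exI[of _ "max n0 (max m m')"] conjI bexI[OF _ a(1)] bexI[OF _ y(1)]) auto
  qed
  then obtain N where N: "\<And>x. x \<in> L \<Longrightarrow> N x \<ge> n0"
    "\<And>x. x \<in> L \<Longrightarrow> \<exists>a \<in> S. \<exists>y \<in> L. f (N x) x \<in> underS (k (N x)) (f (N x) a)
        \<and> f (N x) a \<in> underS (k (N x)) (f (N x) y)"
    by metis
  \<comment> \<open>If every level \<open>n\<close> failed beyond some \<open>b n\<close>, a common bound of the \<open>b n\<close> would leave no level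
    for the elements of \<open>L\<close> above it.\<close>
  have "\<exists>n \<ge> n0. \<forall>b \<in> underS s \<gamma>. \<exists>x \<in> L. N x = n \<and> b \<in> underS s x"
  proof (rule ccontr)
    assume "\<not> ?thesis"
    then have "\<forall>n. \<exists>b \<in> underS s \<gamma>. n \<ge> n0 \<longrightarrow> (\<forall>x \<in> L. N x = n \<longrightarrow> b \<notin> underS s x)"
      by (metis L(2) N(1) nat_le_linear)
    then obtain b where b: "\<And>n. b n \<in> underS s \<gamma>"
      "\<And>n x. n \<ge> n0 \<Longrightarrow> x \<in> L \<Longrightarrow> N x = n \<Longrightarrow> b n \<notin> underS s x"
      by metis
    obtain c where c: "c \<in> underS s \<gamma>" "range b \<subseteq> underS s c"
      using cf[of "range b"] b(1) by auto
    obtain x where "x \<in> L" "c \<in> underS s x" using L(2) c(1) by blast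
    then show False
      using b(2)[OF N(1), of x x] c(2) well_order_underS_trans[OF W, of "b (N x)" c x] by blast
  qed
  then obtain n where n: "n \<ge> n0" "\<And>b. b \<in> underS s \<gamma> \<Longrightarrow> \<exists>x \<in> L. N x = n \<and> b \<in> underS s x"
    by blast
  define Z where "Z = {z \<in> f n ` S. \<exists>x \<in> L. z \<in> underS (k n) (f n x)}"
  have "countable Z"
    unfolding Z_def by (rule countable_subset[OF _ ctbl[of n]]) blast
  have "\<forall>z \<in> Z. \<exists>x. x \<in> L \<and> z \<in> underS (k n) (f n x)"
    by (auto simp: Z_def)
  then obtain w where w: "\<And>z. z \<in> Z \<Longrightarrow> w z \<in> L \<and> z \<in> underS (k n) (f n (w z))"
    by metis
  \<comment> \<open>Countability of the values enters here: all of \<open>Z\<close> is already passed before some \<open>c < \<gamma>\<close>.\<close>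
  obtain c where c: "c \<in> underS s \<gamma>" "w ` Z \<subseteq> underS s c"
    using cf[of "w ` Z"] w L(1) \<open>countable Z\<close> by blast
  obtain x where x: "x \<in> L" "N x = n" "c \<in> underS s x" using n(2) c(1) by blast
  obtain a y where a: "a \<in> S" "y \<in> L" "f n x \<in> underS (k n) (f n a)"
    "f n a \<in> underS (k n) (f n y)"
    using N(2)[OF x(1)] x(2) by blast
  then have z: "f n a \<in> Z" by (auto simp: Z_def)
  have "w (f n a) \<in> underS s x"
    using c(2) z x(3) well_order_underS_trans[OF W] by blast
  then have "f n (w (f n a)) \<in> underS (k n) (f n x)"
    using mono[OF n(1)] w[OF z] x(1) by blast
  then have "f n a \<in> underS (k n) (f n x)"
    using w[OF z] well_order_underS_trans[OF k] by blast
  with a(3) show False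
    using well_order_not_both[OF k] by blast
qed

text \<open>
  The supremum of an increasing \<open>\<omega>\<close>-sequence from \<open>C\<close> starting above \<open>b\<close> is a limit point, and it
  stays below \<open>\<gamma>\<close> because \<open>\<gamma>\<close> has uncountable cofinality.
\<close>

lemma limit_points_cofinal:
  assumes W: "Well_order s" and \<gamma>: "uncountable_cofinality s \<gamma>" and C: "club_in s C \<gamma>"
    and b: "b \<in> underS s \<gamma>"
  shows "\<exists>x \<in> underS s \<gamma>. limit_point_of s C x \<and> b \<in> underS s x"
proof -
  have F: "a \<in> Field s" if "a \<in> underS s \<gamma>" for a
    using that by (auto simp: underS_def Field_def)
  have cf: "\<exists>b \<in> underS s \<gamma>. X \<subseteq> underS s b" if "X \<subseteq> underS s \<gamma>" "countable X" for X
    using \<gamma> that unfolding uncountable_cofinality_def by blast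
  have CS: "C \<subseteq> underS s \<gamma>" and Ccof: "\<And>b. b \<in> underS s \<gamma> \<Longrightarrow> \<exists>c \<in> C. (b, c) \<in> s"
    using C unfolding club_in_def by auto
  have step: "\<exists>c \<in> C. a \<in> underS s c" if a: "a \<in> underS s \<gamma>" for a
  proof -
    obtain d where d: "d \<in> underS s \<gamma>" "a \<in> underS s d" using cf[of "{a}"] a by auto
    obtain c where c: "c \<in> C" "(d, c) \<in> s" using Ccof d(1) by blast
    then have "d = c \<or> d \<in> underS s c" by (auto simp: underS_def)
    then show ?thesis
      using c(1) d(2) well_order_underS_trans[OF W] by blast
  qed
  obtain g where g: "\<And>a. a \<in> underS s \<gamma> \<Longrightarrow> g a \<in> C \<and> a \<in> underS s (g a)"
    using step by metis
  define c where "c = rec_nat (g b) (\<lambda>_. g)"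
  have c: "c n \<in> C" for n
    using g b CS by (induction n) (auto simp: c_def)
  have cs: "c n \<in> underS s (c (Suc n))" for n
    using g c[of n] CS by (auto simp: c_def)
  have c0: "b \<in> underS s (c 0)" using g b by (simp add: c_def)
  define U where "U = {x \<in> underS s \<gamma>. range c \<subseteq> underS s x}"
  have "U \<noteq> {}" "U \<subseteq> Field s"
    using cf[of "range c"] c CS F by (auto simp: U_def)
  then obtain x where x: "x \<in> U" "\<And>y. y \<in> U \<Longrightarrow> y \<notin> underS s x"
    using well_order_least[OF W] by metis
  have xF: "x \<in> underS s \<gamma>" and xc: "\<And>n. c n \<in> underS s x" using x(1) by (auto simp: U_def)
  have "limit_point_of s C x"
    unfolding limit_point_of_def
  proof (intro conjI ballI)
    show "x \<in> Field s" using F xF by blast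
    show "underS s x \<noteq> {}" using xc by blast
    fix d assume d: "d \<in> underS s x"
    then have d\<gamma>: "d \<in> underS s \<gamma>" using xF well_order_underS_trans[OF W] by blast
    then have "d \<notin> U" using x(2) d by blast
    then obtain n where "c n \<notin> underS s d" using d\<gamma> by (auto simp: U_def)
    then have "d = c n \<or> d \<in> underS s (c n)"
      using well_order_linear[OF W F[OF d\<gamma>], of "c n"] c CS F by blast
    then have "d \<in> underS s (c (Suc n))"
      using cs[of n] well_order_underS_trans[OF W] by blast
    then show "\<exists>\<delta> \<in> C \<inter> underS s x. d \<in> underS s \<delta>" using c xc by blast
  qed
  moreover have "b \<in> underS s x" using c0 xc well_order_underS_trans[OF W] by blast
  ultimately show ?thesis using xF by blast
qed

text \<open>
  The sequence \<open>a\<close> witnesses that \<open>r\<close> has cofinality \<open>\<omega>\<close>.  If \<open>C\<close> had the order type of \<open>r\<close>, the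
  isomorphism would carry \<open>a\<close> to a countable set cofinal in \<open>\<gamma>\<close>.
\<close>

lemma small_of_uncountable_cofinality:
  assumes r: "Card_order r" and a: "\<And>n::nat. a n \<in> Field r"
    and acof: "\<And>x. x \<in> Field r \<Longrightarrow> \<exists>n. x \<in> underS r (a n)"
    and W: "Well_order s" and \<gamma>: "uncountable_cofinality s \<gamma>" and C: "club_in s C \<gamma>"
    and le: "Restr s C \<le>o r"
  shows "|C| <o r"
proof (rule ccontr)
  have Wr: "Well_order r" using r by (simp add: card_order_on_well_order_on)
  have CS: "C \<subseteq> underS s \<gamma>" and Ccof: "\<And>b. b \<in> underS s \<gamma> \<Longrightarrow> \<exists>c \<in> C. (b, c) \<in> s"
    using C unfolding club_in_def by auto
  have CF: "C \<subseteq> Field s" using CS by (auto simp: underS_def Field_def)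
  have WR: "Well_order (Restr s C)" by (rule Well_order_Restr[OF W])
  have FR: "Field (Restr s C) = C"
    using W CF by (simp add: Refl_Field_Restr2 order_on_defs)
  assume "\<not> |C| <o r"
  then have "r \<le>o |C|" using Wr card_of_Well_order not_ordLess_iff_ordLeq by blast
  moreover have "|C| \<le>o Restr s C" using card_of_least[OF WR] by (simp add: FR)
  ultimately have "r \<le>o Restr s C" by (rule ordLeq_transitive)
  then have "r =o Restr s C" using le by (simp add: ordIso_iff_ordLeq)
  then obtain h where h: "iso r (Restr s C) h" unfolding ordIso_def by auto
  then have bij: "bij_betw h (Field r) C"
    and ord: "\<And>x y. x \<in> Field r \<Longrightarrow> y \<in> Field r \<Longrightarrow> (x, y) \<in> r \<longleftrightarrow> (h x, h y) \<in> Restr s C"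
    by (auto simp: iso_iff2 FR)
  have "range (\<lambda>n. h (a n)) \<subseteq> C" using bij a by (auto simp: bij_betw_def)
  then have "range (\<lambda>n. h (a n)) \<subseteq> underS s \<gamma> \<and> countable (range (\<lambda>n. h (a n)))"
    using CS by simp
  then obtain b where b: "b \<in> underS s \<gamma>" "range (\<lambda>n. h (a n)) \<subseteq> underS s b"
    using \<gamma> unfolding uncountable_cofinality_def by meson
  obtain c where c: "c \<in> C" "(b, c) \<in> s" using Ccof b(1) by blast
  obtain x where x: "x \<in> Field r" "c = h x" using c bij by (auto simp: bij_betw_def)
  obtain n where n: "x \<in> underS r (a n)" using acof x(1) by blast
  have "(h x, h (a n)) \<in> s" using ord[OF x(1) a] n by (auto simp: underS_def)
  moreover have "b = c \<or> b \<in> underS s c" using c(2) by (auto simp: underS_def)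
  then have "h (a n) \<in> underS s c"
    using b(2) well_order_underS_trans[OF W] by blast
  ultimately show False
    using W x(2) unfolding order_on_defs underS_def antisym_def by blast
qed

section \<open>The alephs below \<open>\<aleph>\<^sub>\<omega>\<close>\<close>

lemma is_aleph_unique:
  fixes s t :: "'a rel"
  shows "is_aleph n s \<Longrightarrow> is_aleph n t \<Longrightarrow> s =o t"
proof (induction n arbitrary: s t)
  case 0
  then show ?case by (auto intro: ordIso_transitive ordIso_symmetric)
next
  case (Suc n)
  then obtain s' t' :: "'a rel" where st: "is_aleph n s'" "s =o cardSuc s'"
    "is_aleph n t'" "t =o cardSuc t'" by auto
  have "Card_order s'" "Card_order t'" using st by (cases n; auto)+
  then have "cardSuc s' =o cardSuc t'"
    using Suc.IH[OF st(1,3)] by (simp add: cardSuc_invar_ordIso)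
  then show ?case using st by (meson ordIso_transitive ordIso_symmetric)
qed

lemma is_aleph_Cinfinite:
  fixes s :: "'a rel"
  shows "is_aleph n s \<Longrightarrow> Cinfinite s"
proof (induction n arbitrary: s)
  case 0
  then show ?case
    using Cinfinite_cong[OF ordIso_symmetric natLeq_Cinfinite] by auto
next
  case (Suc n)
  then obtain s' :: "'a rel" where "is_aleph n s'" "s =o cardSuc s'" by auto
  then show ?case
    using Suc.IH Cinfinite_cong[OF ordIso_symmetric Cinfinite_cardSuc] by blast
qed

lemma regularCard_aleph_Suc:
  fixes s :: "'a rel"
  assumes "is_aleph (Suc n) s"
  shows "regularCard s"
proof -
  obtain s' :: "'a rel" where s': "is_aleph n s'" "s =o cardSuc s'" using assms by auto
  have "Cinfinite s'" using s'(1) by (rule is_aleph_Cinfinite)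
  then show ?thesis
    using regularCard_ordIso[OF ordIso_symmetric[OF s'(2)]] Cinfinite_cardSuc regularCard_cardSuc
    by blast
qed

lemma is_aleph_less_Suc:
  fixes s t :: "'a rel"
  assumes "is_aleph n s" "is_aleph (Suc n) t"
  shows "s <o t"
proof -
  obtain s' :: "'a rel" where s': "is_aleph n s'" "t =o cardSuc s'" using assms by auto
  have "s' <o cardSuc s'"
    using is_aleph_Cinfinite[OF s'(1)] by (simp add: cardSuc_greater)
  then show ?thesis
    using is_aleph_unique[OF assms(1) s'(1)] s'(2)
    by (meson ordIso_ordLess_trans ordLess_ordIso_trans ordIso_symmetric)
qed

text \<open>
  Coordinates for \<open>\<aleph>\<^sub>\<omega>\<close>: \<open>k n\<close> is \<open>\<aleph>\<^bsub>n+1\<^esub>\<close>, realised inside \<open>Field r\<close>, and \<open>a n\<close> is the ordinal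
  \<open>\<omega>\<^sub>n\<close>.  The index shift makes every \<open>k n\<close> regular and strictly larger than the initial segment
  below \<open>a n\<close>.
\<close>

lemma aleph_omega_ladder:
  fixes r :: "'a rel"
  assumes "is_aleph_omega r"
  obtains k :: "nat \<Rightarrow> 'a rel" and a :: "nat \<Rightarrow> 'a" where
    "\<And>n. Cinfinite (k n)" "\<And>n. regularCard (k n)" "\<And>n. Field (k n) \<subseteq> Field r"
    "\<And>m n. m \<le> n \<Longrightarrow> k m \<le>o k n" "\<And>A :: 'b set. |A| <o r \<Longrightarrow> \<exists>n. |A| <o k n"
    "\<And>n. a n \<in> Field r" "\<And>n. |underS r (a n)| <o k n"
    "\<And>x. x \<in> Field r \<Longrightarrow> \<exists>n. x \<in> underS r (a n)"
proof -
  have rC: "Card_order r" using assms by (simp add: is_aleph_omega_def)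
  then have Wr: "Well_order r" by (simp add: card_order_on_well_order_on)
  obtain p :: "nat \<Rightarrow> 'a rel" where p: "\<And>n. is_aleph n (p n)" "\<And>n. p n <o r"
    using assms unfolding is_aleph_omega_def by metis
  have lub: "r \<le>o t" if "Card_order t" "\<And>n. p n \<le>o t" for t :: "'a rel"
  proof -
    have "s \<le>o t" if "is_aleph n s" for n and s :: "'a rel"
      using is_aleph_unique[OF that p(1)] \<open>p n \<le>o t\<close> by (rule ordIso_ordLeq_trans)
    then show ?thesis
      using assms that(1) unfolding is_aleph_omega_def by blast
  qed
  have pC: "Cinfinite (p n)" for n using p(1) by (rule is_aleph_Cinfinite)
  have pS: "p n <o p (Suc n)" for n using p(1) p(1) by (rule is_aleph_less_Suc)
  have pmono: "p m \<le>o p n" if "m \<le> n" for m n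
    using that
  proof (induction rule: dec_induct)
    case base
    show ?case using pC by (simp add: ordLeq_reflexive card_order_on_well_order_on)
  next
    case (step n)
    then show ?case using pS ordLeq_transitive ordLess_imp_ordLeq by blast
  qed
  have "\<forall>n. \<exists>q. Field q \<subseteq> Field r \<and> p (Suc n) =o q \<and> q \<le>o r"
    using ordLess_imp_ordLeq[OF p(2)] internalize_ordLeq[of _ r] by blast
  then obtain k :: "nat \<Rightarrow> 'a rel" where k: "\<And>n. Field (k n) \<subseteq> Field r" "\<And>n. p (Suc n) =o k n"
    by (auto dest!: choice)
  have "\<exists>a \<in> Field r. p n =o Restr r (underS r a)" for n
    using ordLess_iff_ordIso_Restr[OF Wr, of "p n"] p(2) pC
    by (simp add: card_order_on_well_order_on)
  then obtain a where a: "\<And>n. a n \<in> Field r" "\<And>n. p n =o Restr r (underS r (a n))" by metis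
  have pa: "|underS r (a n)| =o p n" for n
  proof -
    have "underS r (a n) \<subseteq> Field r" by (auto simp: underS_def Field_def)
    then have F: "Field (Restr r (underS r (a n))) = underS r (a n)"
      using Wr by (simp add: Refl_Field_Restr2 order_on_defs)
    have "Card_order (Restr r (underS r (a n)))"
      using Card_order_ordIso2[OF _ a(2)] pC by blast
    then have "|underS r (a n)| =o Restr r (underS r (a n))"
      using card_of_Field_ordIso F by metis
    then show ?thesis using a(2) ordIso_symmetric ordIso_transitive by blast
  qed
  show ?thesis
  proof (rule that[of k a])
    show "Cinfinite (k n)" for n using k(2) pC by (rule Cinfinite_cong)
    show "regularCard (k n)" for n
      using k(2) pC regularCard_aleph_Suc[OF p(1)] by (rule regularCard_ordIso)
    show "Field (k n) \<subseteq> Field r" for n by (rule k)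
    show "k m \<le>o k n" if "m \<le> n" for m n
      using pmono[of "Suc m" "Suc n"] that k(2) by (meson Suc_le_mono ordIso_symmetric ordIso_ordLeq_trans ordLeq_ordIso_trans)
    show "a n \<in> Field r" for n by (rule a)
    show "|underS r (a n)| <o k n" for n
      using pa pS k(2) by (meson ordIso_ordLess_trans ordLess_ordIso_trans)
    show "\<exists>n. |A| <o k n" if A: "|A| <o r" for A :: "'b set"
    proof -
      obtain t :: "'a rel" where t: "|A| =o t" "t <o r"
        using A by (auto simp: internalize_ordLess[of "|A|" r])
      have tC: "Card_order t" using Card_order_ordIso2[OF card_of_Card_order t(1)] .
      obtain n where "\<not> p n \<le>o t"
        using lub[OF tC] t(2) not_ordLess_ordLeq by blast
      then have "t <o p n"
        using tC pC by (simp add: card_order_on_well_order_on not_ordLeq_iff_ordLess)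
      then have "|A| <o k n"
        using t(1) pS[of n] k(2)[of n] by (meson ordIso_ordLess_trans ordLess_ordIso_trans ordLess_transitive)
      then show ?thesis ..
    qed
    show "\<exists>n. x \<in> underS r (a n)" if x: "x \<in> Field r" for x
    proof (rule ccontr)
      assume no: "\<not> ?thesis"
      have "p n \<le>o |underS r x|" for n
      proof -
        have "underS r (a n) \<subseteq> underS r x"
          using no well_order_linear[OF Wr x a(1), of n] well_order_underS_trans[OF Wr] by blast
        then have "|underS r (a n)| \<le>o |underS r x|" by (rule card_of_mono1)
        then show ?thesis using ordIso_ordLeq_trans[OF ordIso_symmetric[OF pa]] by blast
      qed
      then have "r \<le>o |underS r x|" using lub[OF card_of_Card_order] by blast
      then show False using card_of_underS[OF rC x] not_ordLess_ordLeq by blast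
    qed
  qed
qed

section \<open>A sparse covering family from square\<close>

text \<open>
  Build \<open>f n \<alpha> < \<omega>\<^bsub>n+1\<^esub>\<close> by recursion on \<open>\<alpha> < \<aleph>\<^bsub>\<omega>+1\<^esub>\<close>, exceeding \<open>f n \<beta>\<close> for all \<open>\<beta>\<close> in a set
  \<open>E n \<alpha>\<close> of size at most \<open>\<aleph>\<^sub>n\<close>.  One part of \<open>E n \<alpha>\<close> comes from an exhaustion of \<open>\<alpha>\<close> by \<open>\<omega>\<close> many
  sets of size below \<open>\<aleph>\<^sub>\<omega>\<close> and makes \<open>f\<close> increasing modulo finite.  The other part is \<open>C \<alpha>\<close> itself
  once it is small enough.  Coherence of the square sequence turns this into uniformity: for limit
  points \<open>\<xi> < \<eta>\<close> of \<open>C \<gamma>\<close> one has \<open>\<xi> \<in> C \<gamma> \<inter> \<eta> = C \<eta>\<close>, hence \<open>f n \<xi> < f n \<eta>\<close> as soon as \<open>n\<close>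
  exceeds a bound that depends on the size of \<open>C \<gamma>\<close> alone.
\<close>

lemma square_sparse_functions:
  fixes r :: "'a rel"
  assumes ao: "is_aleph_omega r" and sq: "square r"
  obtains f :: "nat \<Rightarrow> 'a set \<Rightarrow> 'a" where
    "\<And>n \<alpha>. \<alpha> \<in> Field (cardSuc r) \<Longrightarrow> f n \<alpha> \<in> Field r"
    "\<And>S. S \<subseteq> Field (cardSuc r) \<Longrightarrow> uncountable S \<Longrightarrow> \<exists>n. uncountable (f n ` S)"
proof -
  define s where "s = cardSuc r"
  obtain k :: "nat \<Rightarrow> 'a rel" and a where
    k: "\<And>n. Cinfinite (k n)" "\<And>n. regularCard (k n)" "\<And>n. Field (k n) \<subseteq> Field r"
    and kmono: "\<And>m n. m \<le> n \<Longrightarrow> k m \<le>o k n"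
    and below: "\<And>A :: 'a set set. |A| <o r \<Longrightarrow> \<exists>n. |A| <o k n"
    and a: "\<And>n. a n \<in> Field r" "\<And>n. |underS r (a n)| <o k n"
    "\<And>x. x \<in> Field r \<Longrightarrow> \<exists>n. x \<in> underS r (a n)"
    using aleph_omega_ladder[OF ao] by metis
  have rC: "Card_order r" using ao by (simp add: is_aleph_omega_def)
  obtain p0 :: "'a rel" where p0: "is_aleph 0 p0" "p0 <o r"
    using ao unfolding is_aleph_omega_def by blast
  then have nr: "natLeq <o r" by (auto intro: ordIso_ordLess_trans ordIso_symmetric)
  then have rI: "Cinfinite r"
    using rC cinfinite_mono[OF ordLess_imp_ordLeq natLeq_cinfinite] by blast
  have sI: "Cinfinite s" unfolding s_def using rI by (rule Cinfinite_cardSuc)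
  have sR: "regularCard s" unfolding s_def using rI by (rule regularCard_cardSuc)
  have W: "Well_order s" using sI by (simp add: card_order_on_well_order_on)
  have ns: "cardSuc natLeq <o s"
  proof -
    have "cardSuc natLeq \<le>o r"
      using nr rC by (simp add: cardSuc_ordLess_ordLeq[symmetric] natLeq_Card_order)
    then show ?thesis
      unfolding s_def using cardSuc_greater[OF rC] ordLeq_ordLess_trans by blast
  qed
  obtain C where C: "\<And>\<alpha>. limit_elt s \<alpha> \<Longrightarrow> club_in s (C \<alpha>) \<alpha> \<and> Restr s (C \<alpha>) \<le>o r"
    "\<And>\<alpha> \<beta>. limit_elt s \<alpha> \<Longrightarrow> limit_point_of s (C \<alpha>) \<beta> \<Longrightarrow> C \<beta> = C \<alpha> \<inter> underS s \<beta>"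
    using sq unfolding square_def Let_def s_def by metis
  have "\<exists>h. inj_on h (underS s \<alpha>) \<and> h ` underS s \<alpha> \<subseteq> Field r" if "\<alpha> \<in> Field s" for \<alpha>
  proof -
    have "|underS s \<alpha>| <o s" using sI that by (simp add: card_of_underS)
    then have "|underS s \<alpha>| \<le>o r"
      unfolding s_def using cardSuc_ordLeq_ordLess[OF rC card_of_Card_order] by blast
    then have "|underS s \<alpha>| \<le>o |Field r|"
      using card_of_Field_ordIso[OF rC] ordIso_symmetric ordLeq_ordIso_trans by blast
    then show ?thesis by (simp add: card_of_ordLeq)
  qed
  then obtain h where h: "\<And>\<alpha>. \<alpha> \<in> Field s \<Longrightarrow> inj_on (h \<alpha>) (underS s \<alpha>)"
    "\<And>\<alpha>. \<alpha> \<in> Field s \<Longrightarrow> h \<alpha> ` underS s \<alpha> \<subseteq> Field r" by metis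
  have kW: "Well_order (k n)" for n using k(1) by (simp add: card_order_on_well_order_on)
  define P where "P n \<alpha> = {\<beta> \<in> underS s \<alpha>. h \<alpha> \<beta> \<in> underS r (a n)}" for n \<alpha>
  define Q where "Q n \<alpha> = (if |C \<alpha>| <o k n then C \<alpha> \<inter> underS s \<alpha> else {})" for n \<alpha>
  define E where "E n \<alpha> = (\<Union>m \<in> {..n}. P m \<alpha>) \<union> Q n \<alpha>" for n \<alpha>
  have P: "|P m \<alpha>| <o k n" if "\<alpha> \<in> Field s" "m \<le> n" for m n \<alpha>
  proof -
    have "inj_on (h \<alpha>) (P m \<alpha>)" "h \<alpha> ` P m \<alpha> \<subseteq> underS r (a m)"
      using h(1)[OF that(1)] by (auto simp: P_def inj_on_def)
    then have "|P m \<alpha>| \<le>o |underS r (a m)|" using card_of_ordLeq by blast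
    then show ?thesis
      using a(2) kmono[OF that(2)] by (meson ordLeq_ordLess_trans ordLess_ordLeq_trans)
  qed
  have E: "|E n \<alpha>| <o k n" if "\<alpha> \<in> Field s" for n \<alpha>
  proof -
    have "|{..n}| <o k n"
      using k(1)[of n] finite_ordLess_infinite[OF card_of_Well_order kW, of "{..n}" n]
      by (simp add: cinfinite_def Field_card_of)
    then have 1: "|\<Union>m \<in> {..n}. P m \<alpha>| <o k n"
      using k P[OF that] by (intro card_of_UNION_ordLess_infinite_Field_regularCard) auto
    have "|C \<alpha> \<inter> underS s \<alpha>| \<le>o |C \<alpha>|" by (simp add: card_of_mono1)
    moreover have "|{} :: 'a set set| <o k n"
      using k(1)[of n] finite_ordLess_infinite[OF card_of_Well_order kW, of "{}" n]
      by (simp add: cinfinite_def Field_card_of)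
    ultimately have 2: "|Q n \<alpha>| <o k n" 
      unfolding Q_def using ordLeq_ordLess_trans by auto
    show ?thesis
      unfolding E_def using 1 2 k(1) 
      by (intro card_of_Un_ordLess_infinite_Field) (auto simp: cinfinite_def)
  qed
  have ES: "E n \<alpha> \<subseteq> underS s \<alpha>" for n \<alpha> by (auto simp: E_def P_def Q_def)
  have "\<exists>f. \<forall>\<alpha> \<in> Field s. f \<alpha> \<in> Field (k n) \<and> (\<forall>\<beta> \<in> E n \<alpha>. f \<beta> \<in> underS (k n) (f \<alpha>))" for n
    using W k(1,2) ES E by (rule ex_strictly_increasing_along)
  then obtain f where f: "\<And>n \<alpha>. \<alpha> \<in> Field s \<Longrightarrow> f n \<alpha> \<in> Field (k n)"
    "\<And>n \<alpha> \<beta>. \<alpha> \<in> Field s \<Longrightarrow> \<beta> \<in> E n \<alpha> \<Longrightarrow> f n \<beta> \<in> underS (k n) (f n \<alpha>)" by metis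
  have "\<exists>n. uncountable (f n ` S)" if S: "S \<subseteq> Field s" "uncountable S" for S
  proof -
    obtain \<gamma> where \<gamma>: "uncountable_cofinality s \<gamma>"
      and Scof: "\<And>b. b \<in> underS s \<gamma> \<Longrightarrow> \<exists>a \<in> S \<inter> underS s \<gamma>. b \<in> underS s a"
      using uncountable_set_cofinal_at[OF sI sR ns S] by metis
    have \<gamma>F: "\<gamma> \<in> Field s" and cf: "\<And>X. X \<subseteq> underS s \<gamma> \<Longrightarrow> countable X \<Longrightarrow> \<exists>b \<in> underS s \<gamma>. X \<subseteq> underS s b"
      using \<gamma> unfolding uncountable_cofinality_def by auto
    have lim: "limit_elt s \<gamma>"
      unfolding limit_elt_def
    proof (intro conjI ballI \<gamma>F)
      show "underS s \<gamma> \<noteq> {}" using cf[of "{}"] by auto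
      show "\<exists>c \<in> underS s \<gamma>. b \<in> underS s c" if "b \<in> underS s \<gamma>" for b
        using cf[of "{b}"] that by auto
    qed
    have club: "club_in s (C \<gamma>) \<gamma>" using C(1)[OF lim] by blast
    have "|C \<gamma>| <o r"
      using small_of_uncountable_cofinality[OF rC a(1,3) W \<gamma> club] C(1)[OF lim] by blast
    then obtain n0 where n0: "|C \<gamma>| <o k n0" using below by blast
    define L where "L = {\<xi> \<in> underS s \<gamma>. limit_point_of s (C \<gamma>) \<xi>}"
    have "\<exists>n. uncountable (f n ` (S \<inter> underS s \<gamma>))"
    proof (rule uncountable_values[where L = L and ?n0.0 = n0, OF W kW \<gamma> f(1)])
      show "\<exists>m. \<forall>n \<ge> m. f n \<beta> \<in> underS (k n) (f n \<alpha>)"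
        if "\<alpha> \<in> underS s \<gamma>" "\<beta> \<in> underS s \<alpha>" for \<alpha> \<beta>
      proof -
        have \<alpha>: "\<alpha> \<in> Field s" using that(1) by (auto simp: underS_def Field_def)
        obtain m where "h \<alpha> \<beta> \<in> underS r (a m)" using a(3) h(2)[OF \<alpha>] \<open>\<beta> \<in> underS s \<alpha>\<close> by blast
        then have "\<beta> \<in> E n \<alpha>" if "n \<ge> m" for n
          using that \<open>\<beta> \<in> underS s \<alpha>\<close> by (auto simp: E_def P_def)
        then show ?thesis using f(2)[OF \<alpha>] by blast
      qed
      show "\<exists>x \<in> L. b \<in> underS s x" if "b \<in> underS s \<gamma>" for b
        using limit_points_cofinal[OF W \<gamma> club that] by (auto simp: L_def)
      show "f n \<xi> \<in> underS (k n) (f n \<eta>)"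
        if "n \<ge> n0" "\<xi> \<in> L" "\<eta> \<in> L" "\<xi> \<in> underS s \<eta>" for n \<xi> \<eta>
      proof -
        have \<eta>: "C \<eta> = C \<gamma> \<inter> underS s \<eta>" "\<eta> \<in> Field s"
          using C(2)[OF lim] that(3) by (auto simp: L_def underS_def Field_def)
        have "\<xi> \<in> C \<gamma>" using club that(2) by (auto simp: club_in_def L_def)
        moreover have "|C \<eta>| \<le>o |C \<gamma>|" using \<eta>(1) by (simp add: card_of_mono1)
        then have "|C \<eta>| <o k n"
          using n0 kmono[OF that(1)] by (meson ordLeq_ordLess_trans ordLess_ordLeq_trans)
        ultimately have "\<xi> \<in> E n \<eta>"
          using that(4) \<eta>(1) by (auto simp: E_def Q_def)
        then show ?thesis using f(2) \<eta>(2) by blast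
      qed
    qed (use Scof in \<open>auto simp: L_def\<close>)
    then obtain n where "uncountable (f n ` (S \<inter> underS s \<gamma>))" ..
    moreover have "f n ` (S \<inter> underS s \<gamma>) \<subseteq> f n ` S" by blast
    ultimately show ?thesis using countable_subset by blast
  qed
  then show ?thesis
    using that[of f] f(1) k(3) unfolding s_def by blast
qed

text \<open>
  There are just as many members in a smallest covering family as functions \<open>\<lambda>n. f n \<alpha>\<close>.  Adding to
  each member the range of its own function keeps it countable, and a countable set can swallow only
  countably many of these ranges.
\<close>

lemma sparse_cover_of_square:
  fixes r :: "'a rel"
  assumes ao: "is_aleph_omega r" and sq: "square r" and cov: "cov_eq r natLeq (cardSuc r)"
  obtains \<F> where "\<And>B. B \<in> \<F> \<Longrightarrow> countable B \<and> B \<subseteq> Field r"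
    "\<And>X. countable X \<Longrightarrow> X \<subseteq> Field r \<Longrightarrow> \<exists>B \<in> \<F>. X \<subseteq> B"
    "\<And>Z. countable Z \<Longrightarrow> countable {B \<in> \<F>. B \<subseteq> Z}"
proof -
  have rC: "Card_order r" using ao by (simp add: is_aleph_omega_def)
  obtain f :: "nat \<Rightarrow> 'a set \<Rightarrow> 'a" where
    f: "\<And>n \<alpha>. \<alpha> \<in> Field (cardSuc r) \<Longrightarrow> f n \<alpha> \<in> Field r"
    "\<And>S. S \<subseteq> Field (cardSuc r) \<Longrightarrow> uncountable S \<Longrightarrow> \<exists>n. uncountable (f n ` S)"
    using square_sparse_functions[OF ao sq] by metis
  obtain \<A> where \<A>: "covering_family r natLeq \<A>" "|\<A>| =o cardSuc r"
    using cov unfolding cov_eq_def by blast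
  have "|\<A>| =o |Field (cardSuc r)|"
    using \<A>(2) card_of_Field_ordIso[OF cardSuc_Card_order[OF rC]] ordIso_symmetric ordIso_transitive
    by blast
  then obtain e where "bij_betw e \<A> (Field (cardSuc r))" using card_of_ordIso by blast
  then have e: "inj_on e \<A>" "\<And>A. A \<in> \<A> \<Longrightarrow> e A \<in> Field (cardSuc r)"
    by (auto simp: bij_betw_def)
  define B where "B A = A \<union> range (\<lambda>n. f n (e A))" for A
  have A: "countable A \<and> A \<subseteq> Field r" if "A \<in> \<A>" for A
    using \<A>(1) that unfolding covering_family_def subsets_of_card_def
    by (auto simp: countable_card_le_natLeq ordIso_iff_ordLeq)
  show ?thesis
  proof (rule that[of "B ` \<A>"])
    show "countable C \<and> C \<subseteq> Field r" if "C \<in> B ` \<A>" for C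
      using that A f(1) e(2) by (auto simp: B_def)
  next
    fix X assume X: "countable X" "X \<subseteq> Field r"
    obtain p0 :: "'a rel" where p0: "is_aleph 0 p0" "p0 <o r"
      using ao unfolding is_aleph_omega_def by blast
    then have "Cinfinite r"
      using is_aleph_Cinfinite[OF p0(1)] cinfinite_mono[OF ordLess_imp_ordLeq] rC by blast
    then obtain Y where Y: "countable Y" "infinite Y" "Y \<subseteq> Field r"
      using infinite_countable_subset' by (auto simp: cinfinite_def)
    have "|X \<union> Y| =o natLeq"
      unfolding ordIso_iff_ordLeq countable_card_le_natLeq[symmetric]
        infinite_iff_natLeq_ordLeq[symmetric]
      using X(1) Y(1,2) by (meson countable_Un infinite_Un infinite_iff_natLeq_ordLeq)
    then have "X \<union> Y \<in> subsets_of_card (Field r) natLeq"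
      using X Y by (auto simp: subsets_of_card_def)
    then obtain A where "A \<in> \<A>" "X \<union> Y \<subseteq> A"
      using \<A>(1) unfolding covering_family_def by blast
    then show "\<exists>C \<in> B ` \<A>. X \<subseteq> C" by (auto simp: B_def)
  next
    fix Z :: "'a set" assume Z: "countable Z"
    define T where "T = {A \<in> \<A>. B A \<subseteq> Z}"
    have "f n ` e ` T \<subseteq> Z" for n by (auto simp: T_def B_def)
    then have "countable (e ` T)"
      using f(2)[of "e ` T"] e(2) countable_subset[OF _ Z] by (force simp: T_def)
    then have "countable T"
      using e(1) by (metis (no_types, lifting) T_def countable_image_inj_on inj_on_subset mem_Collect_eq subsetI)
    moreover have "{C \<in> B ` \<A>. C \<subseteq> Z} = B ` T" by (auto simp: T_def)
    ultimately show "countable {C \<in> B ` \<A>. C \<subseteq> Z}" by simp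
  qed
qed

section \<open>The \<open>G\<^sub>\<delta>\<close> topology of the Cantor cube\<close>

definition cylinder :: "'a set \<Rightarrow> ('a \<Rightarrow> bool) \<Rightarrow> 'a set \<Rightarrow> ('a \<Rightarrow> bool) set" where
  "cylinder I x D = {y \<in> (\<Pi>\<^sub>E i\<in>I. UNIV). \<forall>i \<in> D. y i = x i}"

lemma cylinder_antimono: "D \<subseteq> E \<Longrightarrow> cylinder I x E \<subseteq> cylinder I x D"
  unfolding cylinder_def by (simp add: Collect_mono subset_iff)

lemma topspace_cantor_cube: "topspace (cantor_cube I) = (\<Pi>\<^sub>E i\<in>I. UNIV)"
  by (simp add: cantor_cube_def)

lemma openin_G_delta_cylinder:
  assumes "countable D" "D \<subseteq> I"
  shows "openin (G_delta_topology (cantor_cube I)) (cylinder I x D)"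
proof -
  have single: "openin (cantor_cube I) (cylinder I x {i})" if "i \<in> I" for i
  proof -
    have "cylinder I x {i} = (\<Pi>\<^sub>E j\<in>I. if j = i then {x i} else UNIV)"
      using that
      by (auto simp: cylinder_def PiE_iff split: if_split_asm del: PiE_I)
    moreover have "finite {j \<in> I. (if j = i then {x i} else UNIV) \<noteq> (UNIV::bool set)}"
      by (rule finite_subset[of _ "{i}"]) auto
    ultimately show ?thesis
      by (simp add: cantor_cube_def openin_PiE_gen)
  qed
  have "gdelta_in (cantor_cube I) (cylinder I x D)"
  proof (cases "D = {}")
    case True
    then have "cylinder I x D = topspace (cantor_cube I)"
      by (simp add: cylinder_def topspace_cantor_cube)
    then show ?thesis by simp
  next
    case False
    then have "cylinder I x D = \<Inter> ((\<lambda>i. cylinder I x {i}) ` D)"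
      by (auto simp: cylinder_def)
    moreover have "gdelta_in (cantor_cube I) (\<Inter> ((\<lambda>i. cylinder I x {i}) ` D))"
      using assms False single by (intro gdelta_in_Inter) (auto intro: open_imp_gdelta_in)
    ultimately show ?thesis by simp
  qed
  then show ?thesis
    unfolding G_delta_topology_def by (intro topology_generated_by_Basis) simp
qed

lemma topspace_G_delta_cantor_cube:
  "topspace (G_delta_topology (cantor_cube I)) = (\<Pi>\<^sub>E i\<in>I. UNIV)"
proof -
  have "gdelta_in (cantor_cube I) (\<Pi>\<^sub>E i\<in>I. UNIV)"
    using gdelta_in_topspace[of "cantor_cube I"] by (simp add: topspace_cantor_cube)
  then show ?thesis
    unfolding G_delta_topology_def topology_generated_by_topspace
    using gdelta_in_subset[of "cantor_cube I"] unfolding topspace_cantor_cube by blast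
qed

lemma open_contains_finite_cylinder:
  assumes "openin (cantor_cube I) U" "x \<in> U"
  shows "\<exists>D \<subseteq> I. finite D \<and> cylinder I x D \<subseteq> U"
proof -
  obtain V where V: "finite {i \<in> I. V i \<noteq> UNIV}" "x \<in> Pi\<^sub>E I V" "Pi\<^sub>E I V \<subseteq> U"
    using assms unfolding cantor_cube_def openin_product_topology_alt by auto
  have "cylinder I x {i \<in> I. V i \<noteq> UNIV} \<subseteq> Pi\<^sub>E I V"
  proof
    fix y assume y: "y \<in> cylinder I x {i \<in> I. V i \<noteq> UNIV}"
    show "y \<in> Pi\<^sub>E I V"
    proof (rule PiE_I)
      fix i assume i: "i \<in> I"
      show "y i \<in> V i"
      proof (cases "V i = UNIV")
        case False
        then have "y i = x i" using y i unfolding cylinder_def by blast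
        then show ?thesis using V(2) i by (simp only: PiE_mem)
      qed simp
    next
      fix i assume "i \<notin> I"
      then show "y i = undefined"
        using y PiE_arb[of y I "\<lambda>_. UNIV" i] unfolding cylinder_def by blast
    qed
  qed
  with V show ?thesis by (intro exI[of _ "{i \<in> I. V i \<noteq> UNIV}"]) auto
qed

text \<open>
  The cylinders over countable sets of coordinates are thus a base of the \<open>G\<^sub>\<delta>\<close> topology.
\<close>

lemma G_delta_open_contains_cylinder:
  assumes "openin (G_delta_topology (cantor_cube I)) U" "x \<in> U"
  shows "\<exists>D \<subseteq> I. countable D \<and> cylinder I x D \<subseteq> U"
proof -
  have "generate_topology_on {S. gdelta_in (cantor_cube I) S} U"
    using assms(1) unfolding G_delta_topology_def by (rule openin_topology_generated_by)
  then show ?thesis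
    using assms(2)
  proof (induction arbitrary: x rule: generate_topology_on.induct)
    case Empty
    then show ?case by simp
  next
    case (Int a b)
    then obtain D E where "D \<subseteq> I" "countable D" "cylinder I x D \<subseteq> a"
      "E \<subseteq> I" "countable E" "cylinder I x E \<subseteq> b" by (meson IntE)
    then show ?case
      by (intro exI[of _ "D \<union> E"]) (auto simp only: cylinder_def Un_iff intro!: countable_Un)
  next
    case (UN K)
    then obtain V where V: "V \<in> K" "x \<in> V" by blast
    then show ?case using UN.IH[OF V] by blast
  next
    case (Basis s)
    then have "(countable intersection_of openin (cantor_cube I)) s"
      by (simp add: gdelta_in_alt)
    then obtain \<U> where \<U>: "countable \<U>" "\<And>V. V \<in> \<U> \<Longrightarrow> openin (cantor_cube I) V" "\<Inter>\<U> = s"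
      by (auto simp: intersection_of_def)
    have "\<exists>D \<subseteq> I. finite D \<and> cylinder I x D \<subseteq> V" if "V \<in> \<U>" for V
      using open_contains_finite_cylinder[OF \<U>(2)[OF that]] that \<U>(3) Basis.prems by blast
    then obtain D where D: "\<And>V. V \<in> \<U> \<Longrightarrow> D V \<subseteq> I \<and> finite (D V) \<and> cylinder I x (D V) \<subseteq> V"
      by metis
    have "cylinder I x (\<Union> (D ` \<U>)) \<subseteq> \<Inter>\<U>"
    proof
      fix y assume "y \<in> cylinder I x (\<Union> (D ` \<U>))"
      then have "y \<in> cylinder I x (D V)" if "V \<in> \<U>" for V
        using that by (auto simp: cylinder_def)
      then show "y \<in> \<Inter>\<U>" using D by blast
    qed
    then show ?case
      using D \<U>(1,3)
      by (intro exI[of _ "\<Union> (D ` \<U>)"] conjI UN_least countable_UN) (auto intro: countable_finite)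
  qed
qed

text \<open>
  A cylinder determines its set of coordinates: flipping the value of \<open>x\<close> at a coordinate outside
  \<open>A\<close> does not leave the smaller cylinder.
\<close>

lemma cylinder_subset_cylinder:
  assumes "x \<in> (\<Pi>\<^sub>E i\<in>I. UNIV)" "B \<subseteq> I" "cylinder I x A \<subseteq> cylinder I y B"
  shows "B \<subseteq> A" and "cylinder I y B = cylinder I x B"
proof -
  show "B \<subseteq> A"
  proof
    fix i assume i: "i \<in> B"
    show "i \<in> A"
    proof (rule ccontr)
      assume "i \<notin> A"
      then have "x(i := \<not> x i) \<in> cylinder I x A" "x \<in> cylinder I x A"
        using assms(1,2) i by (auto simp: cylinder_def PiE_iff extensional_def)
      then have "x(i := \<not> x i) \<in> cylinder I y B" "x \<in> cylinder I y B"
        using assms(3) by blast+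
      then show False using i by (auto simp: cylinder_def)
    qed
  qed
  have "x \<in> cylinder I y B"
    using assms(1,3) by (auto simp: cylinder_def)
  then show "cylinder I y B = cylinder I x B"
    by (auto simp: cylinder_def)
qed

lemma countable_iff_ordLess_aleph1: "countable A \<longleftrightarrow> |A| <o cardSuc natLeq"
proof -
  have "countable A \<longleftrightarrow> |A| \<le>o natLeq"
    by (rule countable_card_le_natLeq)
  also have "\<dots> \<longleftrightarrow> |A| <o cardSuc natLeq"
    by (rule cardSuc_ordLeq_ordLess[OF natLeq_Card_order card_of_Card_order, symmetric])
  finally show ?thesis .
qed

text \<open>
  Use the cylinders over members of \<open>\<F>\<close>.  Those containing a given cylinder over \<open>A\<close> are determined
  by their sets of coordinates, which are members of \<open>\<F>\<close> inside the countable set \<open>A\<close>.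
\<close>

lemma op_like_base_of_sparse_cover:
  assumes sub: "\<And>B. B \<in> \<F> \<Longrightarrow> countable B \<and> B \<subseteq> I"
    and cover: "\<And>X. countable X \<Longrightarrow> X \<subseteq> I \<Longrightarrow> \<exists>B \<in> \<F>. X \<subseteq> B"
    and sparse: "\<And>Z. countable Z \<Longrightarrow> countable {B \<in> \<F>. B \<subseteq> Z}"
  shows "\<exists>\<B>. base_of (G_delta_topology (cantor_cube I)) \<B> \<and> op_like (cardSuc natLeq) \<B>"
proof (intro exI conjI)
  let ?P = "(\<Pi>\<^sub>E i\<in>I. UNIV) :: ('a \<Rightarrow> bool) set"
  let ?\<B> = "{cylinder I x B | x B. x \<in> ?P \<and> B \<in> \<F>}"
  show "base_of (G_delta_topology (cantor_cube I)) ?\<B>"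
    unfolding base_of_def
  proof (intro conjI allI impI)
    show "\<forall>V \<in> ?\<B>. openin (G_delta_topology (cantor_cube I)) V"
      using sub by (auto intro: openin_G_delta_cylinder)
  next
    fix U x assume U: "openin (G_delta_topology (cantor_cube I)) U \<and> x \<in> U"
    then have x: "x \<in> ?P"
      using openin_subset[of _ U] unfolding topspace_G_delta_cantor_cube[symmetric] by blast
    obtain D where D: "D \<subseteq> I" "countable D" "cylinder I x D \<subseteq> U"
      using G_delta_open_contains_cylinder[OF conjunct1[OF U] conjunct2[OF U]] by blast
    obtain B where B: "B \<in> \<F>" "D \<subseteq> B" using cover D by blast
    have "x \<in> cylinder I x B"
      using x by (simp add: cylinder_def)
    moreover have "cylinder I x B \<subseteq> cylinder I x D"
      using B(2) by (rule cylinder_antimono)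
    then have "cylinder I x B \<subseteq> U"
      using D(3) by (rule order_trans)
    moreover have "cylinder I x B \<in> ?\<B>"
      using x B(1) by blast
    ultimately show "\<exists>V \<in> ?\<B>. x \<in> V \<and> V \<subseteq> U" by (intro bexI conjI)
  qed
  show "op_like (cardSuc natLeq) ?\<B>"
    unfolding op_like_def
  proof
    fix U assume "U \<in> ?\<B>"
    then obtain x A where x: "U = cylinder I x A" "x \<in> ?P" "A \<in> \<F>" by blast
    have "{V \<in> ?\<B>. U \<subseteq> V} \<subseteq> cylinder I x ` {B \<in> \<F>. B \<subseteq> A}"
    proof
      fix V assume "V \<in> {V \<in> ?\<B>. U \<subseteq> V}"
      then obtain y B where V: "V = cylinder I y B" "B \<in> \<F>" "U \<subseteq> V" by blast
      then show "V \<in> cylinder I x ` {B \<in> \<F>. B \<subseteq> A}"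
        using cylinder_subset_cylinder[of x I B A y] x sub by blast
    qed
    moreover have "countable (cylinder I x ` {B \<in> \<F>. B \<subseteq> A})"
      using sparse sub x(3) by blast
    ultimately have "countable {V \<in> ?\<B>. U \<subseteq> V}"
      using countable_subset by blast
    then show "|{V \<in> ?\<B>. U \<subseteq> V}| <o cardSuc natLeq"
      by (simp only: countable_iff_ordLess_aleph1)
  qed
qed

text \<open>
  There are no isolated points, so a point has a strictly decreasing sequence of basic
  neighbourhoods.  The intersection of the sequence is again a neighbourhood, and a basic set inside
  it has the whole sequence above it.
\<close>

lemma base_has_set_with_infinitely_many_supersets:
  assumes I: "uncountable I" and base: "base_of (G_delta_topology (cantor_cube I)) \<B>"
  shows "\<exists>U \<in> \<B>. infinite {V \<in> \<B>. U \<subseteq> V}"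
proof -
  let ?X = "G_delta_topology (cantor_cube I)"
  define x :: "'a \<Rightarrow> bool" where "x = (\<lambda>i\<in>I. True)"
  have x: "x \<in> (\<Pi>\<^sub>E i\<in>I. UNIV)" by (simp add: x_def)
  have ex: "\<exists>V \<in> \<B>. x \<in> V \<and> V \<subseteq> U" if "openin ?X U" "x \<in> U" for U
    using base that unfolding base_of_def by blast
  have op: "openin ?X V" if "V \<in> \<B>" for V
    using base that unfolding base_of_def by blast
  have smaller: "\<exists>V \<in> \<B>. x \<in> V \<and> V \<subset> U" if U: "openin ?X U" "x \<in> U" for U
  proof -
    obtain D where D: "D \<subseteq> I" "countable D" "cylinder I x D \<subseteq> U"
      using G_delta_open_contains_cylinder[OF U] by blast
    then obtain i where i: "i \<in> I" "i \<notin> D" using I by (metis subset_antisym subsetI)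
    have "openin ?X (cylinder I x (insert i D))"
      using D i by (intro openin_G_delta_cylinder) auto
    then obtain V where V: "V \<in> \<B>" "x \<in> V" "V \<subseteq> cylinder I x (insert i D)"
      using ex x by (fastforce simp: cylinder_def)
    have "x(i := \<not> x i) \<in> cylinder I x D" "x(i := \<not> x i) \<notin> cylinder I x (insert i D)"
      using x i by (auto simp: cylinder_def PiE_iff extensional_def)
    moreover have "V \<subseteq> U"
      using V(3) D(3) cylinder_antimono[OF subset_insertI[of D i], of I x]
      by (meson order_trans)
    ultimately show ?thesis using V D(3) by blast
  qed
  have "\<exists>V. \<forall>n::nat. (V n \<in> \<B> \<and> x \<in> V n) \<and> V (Suc n) \<subset> V n"
  proof (rule dependent_nat_choice)
    show "\<exists>V. V \<in> \<B> \<and> x \<in> V"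
      using ex[OF openin_topspace] x[folded topspace_G_delta_cantor_cube] by blast
    show "\<exists>W. (W \<in> \<B> \<and> x \<in> W) \<and> W \<subset> V" if "V \<in> \<B> \<and> x \<in> V" for V
      using smaller[OF op, of V] that by blast
  qed
  then obtain V where chain: "\<forall>n::nat. (V n \<in> \<B> \<and> x \<in> V n) \<and> V (Suc n) \<subset> V n" ..
  have V: "V n \<in> \<B>" "x \<in> V n" "V (Suc n) \<subset> V n" for n
    using chain[rule_format, of n] by auto
  have "\<exists>D \<subseteq> I. countable D \<and> cylinder I x D \<subseteq> V n" for n
    using G_delta_open_contains_cylinder[OF op[OF V(1)] V(2)] .
  then obtain D where D: "\<And>n. D n \<subseteq> I" "\<And>n. countable (D n)" "\<And>n. cylinder I x (D n) \<subseteq> V n"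
    by metis
  have "openin ?X (cylinder I x (\<Union> (range D)))"
    using D by (intro openin_G_delta_cylinder) auto
  then obtain U where U: "U \<in> \<B>" "U \<subseteq> cylinder I x (\<Union> (range D))"
    using ex x by (fastforce simp: cylinder_def)
  have "U \<subseteq> V n" for n
    using U(2) D(3)[of n] cylinder_antimono[of "D n" "\<Union> (range D)" I x]
    by (meson UNIV_I UN_upper order_trans)
  then have "range V \<subseteq> {V \<in> \<B>. U \<subseteq> V}" using V(1) by blast
  moreover have "inj V"
  proof (rule linorder_injI)
    fix m n :: nat assume "m < n"
    then have "V n \<subset> V m"
      using lift_Suc_antimono_le[of V "Suc m" n] V(3) by (meson Suc_leI psubset_imp_subset subset_psubset_trans)
    then show "V m \<noteq> V n" by blast
  qed
  then have "infinite (range V)" by (simp add: finite_image_iff)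
  ultimately show ?thesis using U(1) infinite_super by blast
qed

lemma Nt_G_delta_cantor_cube_ge_aleph1:
  assumes I: "uncountable I" and base: "base_of (G_delta_topology (cantor_cube I)) \<B>"
    and "op_like \<mu> \<B>" and "Cinfinite \<mu>"
  shows "cardSuc natLeq \<le>o \<mu>"
proof -
  obtain U where U: "U \<in> \<B>" "infinite {V \<in> \<B>. U \<subseteq> V}"
    using base_has_set_with_infinitely_many_supersets[OF I base] by blast
  have "natLeq \<le>o |{V \<in> \<B>. U \<subseteq> V}|"
    using U(2) infinite_iff_natLeq_ordLeq by blast
  moreover have "|{V \<in> \<B>. U \<subseteq> V}| <o \<mu>"
    using assms(3) U(1) by (simp add: op_like_def)
  ultimately have "natLeq <o \<mu>" by (rule ordLeq_ordLess_trans)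
  then show ?thesis
    using assms(4) by (simp add: cardSuc_ordLess_ordLeq natLeq_Card_order)
qed

section \<open>The Noetherian type\<close>

theorem corollary3p24:
  fixes r :: "'a rel"
  assumes "is_aleph_omega r"
    and "square r"
    and "cov_eq r natLeq (cardSuc r)"
  shows "Nt_eq (G_delta_topology (cantor_cube (Field r))) (cardSuc natLeq)"
proof (rule sparse_cover_of_square[OF assms])
  fix \<F> :: "'a set set"
  assume \<F>: "\<And>B. B \<in> \<F> \<Longrightarrow> countable B \<and> B \<subseteq> Field r"
    "\<And>X. countable X \<Longrightarrow> X \<subseteq> Field r \<Longrightarrow> \<exists>B \<in> \<F>. X \<subseteq> B"
    "\<And>Z. countable Z \<Longrightarrow> countable {B \<in> \<F>. B \<subseteq> Z}"
  have base: "\<exists>\<B>. base_of (G_delta_topology (cantor_cube (Field r))) \<B> \<and> op_like (cardSuc natLeq) \<B>"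
    by (rule op_like_base_of_sparse_cover[OF \<F>])
  have "uncountable (Field r)"
  proof
    assume "countable (Field r)"
    then have "|Field r| \<le>o natLeq"
      by (simp only: countable_card_le_natLeq)
    moreover have "Card_order r"
      using assms(1) by (simp add: is_aleph_omega_def)
    ultimately have "r \<le>o natLeq"
      using card_of_Field_ordIso ordIso_ordLeq_trans ordIso_symmetric by metis
    moreover obtain p :: "'a rel" where "is_aleph 0 p" "p <o r"
      using assms(1) unfolding is_aleph_omega_def by blast
    then have "natLeq <o r"
      by (auto intro: ordIso_ordLess_trans ordIso_symmetric)
    ultimately show False
      using not_ordLess_ordLeq by blast
  qed
  then have lower: "\<forall>\<mu> :: nat set rel. Cinfinite \<mu> \<and>
      (\<exists>\<B>. base_of (G_delta_topology (cantor_cube (Field r))) \<B> \<and> op_like \<mu> \<B>) \<longrightarrow> cardSuc natLeq \<le>o \<mu>"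
    using Nt_G_delta_cantor_cube_ge_aleph1 by blast
  show ?thesis
    unfolding Nt_eq_def
    by (rule conjI[OF Cinfinite_cardSuc[OF natLeq_Cinfinite] conjI[OF base lower]])
qed

end
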